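(* Let $X=\varprojlim X_np_n$ be a reduced regular projective limit of vector lattices, $X_0\subset X$ a vector subspace, $q_1\colon X_1\to\mathbb R$ increasing and concave, $q:=q_1\circ\operatorname{pr}_1$, $H\subset X$ convex, $H_n:=\operatorname{pr}_nH$. Assume: (ii) for each $n$, $H_n$ is minorizing for $\operatorname{pr}_nX_0$; (v) for every decreasing sequence $(h^{(k)})\subset H$ with $\inf_kq(h^{(k)})\in\mathbb R$, the sequence is bounded below in $X$ and $q(\inf_kh^{(k)})\ge\inf_kq(h^{(k)})$; (iii–iv) for every sequence $(h^{(k)})\subset H$ bounded in $X$, $\limsup_kh^{(k)}:=\inf_n\sup_{k\ge n}h^{(k)}$ exists and belongs to $H$. Then $\mathrm{spf}_{H,q}$ is a concave function with values in $\mathbb R\cup\{-\infty\}$, and for all $x\in X_0$ $$\mathrm{spf}_{H,q}(x)=\inf\{a(x):\ a\in L,\ q(h)\le a(x')\ \text{for all }h\in H,\ x'\in X_0,\ h\le x'\}$$ where $L$ is the set of all affine functions $X_0\to\mathbb R$. If moreover $0\in H$ and $q_1(0)\ge0$, then $\mathrm{spf}_{H,q}$ is positive and $L$ may be replaced by $\{l+c:\ l\colon X_0\to\mathbb R\text{ positive linear},\ c\in\mathbb R,\ c\ge0\}$.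
   Context: All vector spaces are real. Projective limit: for ordered vector spaces $(X_n,\le_n)$ and positive linear $p_n\colon X_{n+1}\to X_n$, $X=\varprojlim X_np_n=\{x=(x_n)\in\prod X_n:\ x_n=p_n(x_{n+1})\ \forall n\}$ with coordinatewise order, $\operatorname{pr}_nx=x_n$; regular if all $X_n$ are vector lattices and each $p_n$ preserves suprema of finite sets; reduced if $\operatorname{pr}_nX=X_n$ for all $n$. A set $G\subset X_n$ is minorizing for $Y$ if each $y\in Y$ has some $g\in G$ with $g\le_ny$. Supremal function: $\mathrm{spf}_{H,q}(x)=\sup\{q(h):\ h\in H,\ h\le x\}$, $\sup\varnothing=-\infty$. A function $a$ on a vector space is affine if $a(tx_1+(1-t)x_2)=ta(x_1)+(1-t)a(x_2)$ for all $x_1,x_2$, $t\in\mathbb R$. Positive: $g(x)\ge0$ for $x\ge0$. *)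

theory Defs
  imports Complex_Main "HOL-Library.Extended_Real"
begin

text \<open>Ordered vector spaces are modelled as carrier subspaces V of an ambient real
vector space type, together with an order relation le on V.\<close>

definition is_sup_in :: "'a set \<Rightarrow> ('a \<Rightarrow> 'a \<Rightarrow> bool) \<Rightarrow> 'a set \<Rightarrow> 'a \<Rightarrow> bool" where
  "is_sup_in S le A s \<longleftrightarrow> s \<in> S \<and> (\<forall>a\<in>A. le a s) \<and> (\<forall>u\<in>S. (\<forall>a\<in>A. le a u) \<longrightarrow> le s u)"

definition is_inf_in :: "'a set \<Rightarrow> ('a \<Rightarrow> 'a \<Rightarrow> bool) \<Rightarrow> 'a set \<Rightarrow> 'a \<Rightarrow> bool" where
  "is_inf_in S le A s \<longleftrightarrow> s \<in> S \<and> (\<forall>a\<in>A. le s a) \<and> (\<forall>u\<in>S. (\<forall>a\<in>A. le u a) \<longrightarrow> le u s)"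

definition ordered_vs :: "'v::real_vector set \<Rightarrow> ('v \<Rightarrow> 'v \<Rightarrow> bool) \<Rightarrow> bool" where
  "ordered_vs V le \<longleftrightarrow>
     0 \<in> V \<and> (\<forall>x\<in>V. \<forall>y\<in>V. x + y \<in> V) \<and> (\<forall>x\<in>V. \<forall>c::real. c *\<^sub>R x \<in> V) \<and>
     (\<forall>x\<in>V. le x x) \<and>
     (\<forall>x\<in>V. \<forall>y\<in>V. le x y \<and> le y x \<longrightarrow> x = y) \<and>
     (\<forall>x\<in>V. \<forall>y\<in>V. \<forall>z\<in>V. le x y \<and> le y z \<longrightarrow> le x z) \<and>
     (\<forall>x\<in>V. \<forall>y\<in>V. \<forall>z\<in>V. le x y \<longrightarrow> le (x + z) (y + z)) \<and>
     (\<forall>x\<in>V. \<forall>y\<in>V. \<forall>c::real. le x y \<and> 0 \<le> c \<longrightarrow> le (c *\<^sub>R x) (c *\<^sub>R y))"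

definition vector_lattice :: "'v::real_vector set \<Rightarrow> ('v \<Rightarrow> 'v \<Rightarrow> bool) \<Rightarrow> bool" where
  "vector_lattice V le \<longleftrightarrow> ordered_vs V le \<and> (\<forall>x\<in>V. \<forall>y\<in>V. \<exists>s. is_sup_in V le {x, y} s)"

definition regular_proj_system ::
  "(nat \<Rightarrow> 'v::real_vector set) \<Rightarrow> (nat \<Rightarrow> 'v \<Rightarrow> 'v \<Rightarrow> bool) \<Rightarrow> (nat \<Rightarrow> 'v \<Rightarrow> 'v) \<Rightarrow> bool" where
  "regular_proj_system V le p \<longleftrightarrow>
     (\<forall>n. vector_lattice (V n) (le n)) \<and>
     (\<forall>n. p n ` V (Suc n) \<subseteq> V n \<and>
          (\<forall>x\<in>V (Suc n). \<forall>y\<in>V (Suc n). p n (x + y) = p n x + p n y) \<and>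
          (\<forall>x\<in>V (Suc n). \<forall>c::real. p n (c *\<^sub>R x) = c *\<^sub>R p n x) \<and>
          (\<forall>x\<in>V (Suc n). le (Suc n) 0 x \<longrightarrow> le n 0 (p n x)) \<and>
          (\<forall>A s. finite A \<and> A \<noteq> {} \<and> A \<subseteq> V (Suc n) \<and> is_sup_in (V (Suc n)) (le (Suc n)) A s
               \<longrightarrow> is_sup_in (V n) (le n) (p n ` A) (p n s)))"

definition plim :: "(nat \<Rightarrow> 'v set) \<Rightarrow> (nat \<Rightarrow> 'v \<Rightarrow> 'v) \<Rightarrow> (nat \<Rightarrow> 'v) set" where
  "plim V p = {x. \<forall>n. x n \<in> V n \<and> x n = p n (x (Suc n))}"

definition plim_le :: "(nat \<Rightarrow> 'v \<Rightarrow> 'v \<Rightarrow> bool) \<Rightarrow> (nat \<Rightarrow> 'v) \<Rightarrow> (nat \<Rightarrow> 'v) \<Rightarrow> bool" where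
  "plim_le le x y \<longleftrightarrow> (\<forall>n. le n (x n) (y n))"

definition reduced :: "(nat \<Rightarrow> 'v set) \<Rightarrow> (nat \<Rightarrow> 'v \<Rightarrow> 'v) \<Rightarrow> bool" where
  "reduced V p \<longleftrightarrow> (\<forall>n. (\<lambda>x. x n) ` plim V p = V n)"

definition padd :: "(nat \<Rightarrow> 'v::real_vector) \<Rightarrow> (nat \<Rightarrow> 'v) \<Rightarrow> nat \<Rightarrow> 'v" where
  "padd x y = (\<lambda>n. x n + y n)"

definition psc :: "real \<Rightarrow> (nat \<Rightarrow> 'v::real_vector) \<Rightarrow> nat \<Rightarrow> 'v" where
  "psc c x = (\<lambda>n. c *\<^sub>R x n)"

definition cmb :: "real \<Rightarrow> (nat \<Rightarrow> 'v::real_vector) \<Rightarrow> (nat \<Rightarrow> 'v) \<Rightarrow> nat \<Rightarrow> 'v" where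
  "cmb t x y = (\<lambda>n. t *\<^sub>R x n + (1 - t) *\<^sub>R y n)"

text \<open>Supremal function, with values in the extended reals (Sup {} = -\<infinity>).\<close>

definition spf :: "'x set \<Rightarrow> ('x \<Rightarrow> 'x \<Rightarrow> bool) \<Rightarrow> ('x \<Rightarrow> real) \<Rightarrow> 'x \<Rightarrow> ereal" where
  "spf H le q x = Sup ((\<lambda>h. ereal (q h)) ` {h \<in> H. le h x})"

end

theory Submission
  imports Defs "HOL-Analysis.Convex" "HOL-Library.Function_Algebras"
begin

text \<open>Let \<open>S\<^sub>n x\<close> be the supremum of \<open>q h\<close> over the \<open>h \<in> H\<close> that lie below \<open>x\<close> at level \<open>n\<close> only.
  Since \<open>H\<^sub>n\<close> is minorizing, \<open>S\<^sub>n\<close> is a finite concave function on all of \<open>X\<^sub>0\<close>, so by Hahn--Banach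
  it has an affine majorant touching it at any given point, and this majorant is admissible in
  the infimum. It remains to see that \<open>spf = inf\<^sub>n S\<^sub>n\<close>. If \<open>h\<^sub>n \<in> H\<close> lies below \<open>x\<close> at level \<open>n\<close> and
  \<open>q h\<^sub>n \<ge> c\<close>, then the tails of \<open>(h\<^sub>n)\<close> are bounded above in \<open>X\<close>. Condition (iii--iv) for the sequence
  \<open>x, y, x, y, \<dots>\<close> closes \<open>H\<close> under binary joins, hence the tails have suprema in \<open>H\<close>; these decrease,
  and by (v) their infimum is an element \<open>l \<in> H\<close> with \<open>l \<le> x\<close> and \<open>q l \<ge> c\<close>.\<close>

section \<open>Supporting functionals of concave functions\<close>

definition sublinear :: "('a::real_vector \<Rightarrow> real) \<Rightarrow> bool" where
  "sublinear N \<longleftrightarrow> (\<forall>x y. N (x + y) \<le> N x + N y) \<and> (\<forall>t>0. \<forall>x. N (t *\<^sub>R x) \<le> t * N x)"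

lemma sublinear_add: "sublinear N \<Longrightarrow> N (x + y) \<le> N x + N y"
  by (simp add: sublinear_def)

lemma sublinear_scale:
  assumes "sublinear N" "0 < t"
  shows "N (t *\<^sub>R x) = t * N x"
proof (rule antisym)
  show "N (t *\<^sub>R x) \<le> t * N x" using assms by (simp add: sublinear_def)
  have "N ((1 / t) *\<^sub>R (t *\<^sub>R x)) \<le> (1 / t) * N (t *\<^sub>R x)"
    using assms unfolding sublinear_def by (meson zero_less_divide_1_iff)
  then show "t * N x \<le> N (t *\<^sub>R x)" using assms(2) by (simp add: field_simps)
qed

lemma sublinear_zero: "sublinear N \<Longrightarrow> N 0 = 0"
  using sublinear_scale[of N 2 0] by simp

lemma sublinear_ge: "sublinear N \<Longrightarrow> - N (- x) \<le> N x"
  using sublinear_add[of N x "- x"] by (simp add: sublinear_zero)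

lemma chain_INF_sublinear:
  assumes ne: "C \<noteq> {}"
    and C: "\<And>g. g \<in> C \<Longrightarrow> sublinear g \<and> g \<le> N"
    and chain: "\<And>f g. f \<in> C \<Longrightarrow> g \<in> C \<Longrightarrow> f \<le> g \<or> g \<le> f"
  shows "sublinear (\<lambda>x. INF g\<in>C. g x)" and "\<And>g x. g \<in> C \<Longrightarrow> (INF g\<in>C. g x) \<le> g x"
proof -
  have bdd: "bdd_below ((\<lambda>g. g x) ` C)" for x
  proof (rule bdd_belowI2)
    fix g assume "g \<in> C"
    then show "- N (- x) \<le> g x"
      using sublinear_ge[of g x] C[of g] by (auto simp: le_fun_def intro: order_trans[rotated])
  qed
  show low: "(INF g\<in>C. g x) \<le> g x" if "g \<in> C" for g x
    using bdd that by (rule cINF_lower)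
  show "sublinear (\<lambda>x. INF g\<in>C. g x)"
    unfolding sublinear_def
  proof (intro conjI allI impI)
    fix x y
    have pair: "(INF g\<in>C. g (x + y)) \<le> f x + g y" if fg: "f \<in> C" "g \<in> C" for f g
    proof -
      obtain h where h: "h \<in> C" "h \<le> f" "h \<le> g"
        using chain[OF fg] fg by (metis order_refl)
      have "(INF g\<in>C. g (x + y)) \<le> h (x + y)" using h by (intro low)
      also have "\<dots> \<le> h x + h y" using C h by (intro sublinear_add) auto
      also have "\<dots> \<le> f x + g y" using h by (intro add_mono) (auto simp: le_fun_def)
      finally show ?thesis .
    qed
    have "(INF g\<in>C. g (x + y)) - (INF g\<in>C. g y) \<le> f x" if "f \<in> C" for f
    proof -
      have "(INF g\<in>C. g (x + y)) - f x \<le> (INF g\<in>C. g y)"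
      proof (rule cINF_greatest[OF ne])
        fix g assume "g \<in> C"
        then show "(INF g\<in>C. g (x + y)) - f x \<le> g y" using pair[OF that, of g] by linarith
      qed
      then show ?thesis by simp
    qed
    then have "(INF g\<in>C. g (x + y)) - (INF g\<in>C. g y) \<le> (INF g\<in>C. g x)"
      using ne by (intro cINF_greatest)
    then show "(INF g\<in>C. g (x + y)) \<le> (INF g\<in>C. g x) + (INF g\<in>C. g y)" by simp
  next
    fix t :: real and x assume t: "0 < t"
    have "(INF g\<in>C. g (t *\<^sub>R x)) / t \<le> (INF g\<in>C. g x)"
    proof (rule cINF_greatest[OF ne])
      fix g assume "g \<in> C"
      then have "(INF g\<in>C. g (t *\<^sub>R x)) \<le> t * g x"
        using low[of g "t *\<^sub>R x"] C[of g] sublinear_scale[of g t x] t by simp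
      then show "(INF g\<in>C. g (t *\<^sub>R x)) / t \<le> g x" using t by (simp add: field_simps)
    qed
    then show "(INF g\<in>C. g (t *\<^sub>R x)) \<le> t * (INF g\<in>C. g x)" using t by (simp add: field_simps)
  qed
qed

lemma sublinear_shift:
  assumes m: "sublinear m"
  defines "m' y z \<equiv> INF t\<in>{0..}. m (z + t *\<^sub>R y) - t * m y"
  shows "sublinear (m' y)" and "m' y z \<le> m z" and "m' y z \<le> m (z + y) - m y"
proof -
  have bdd: "bdd_below ((\<lambda>t. m (z + t *\<^sub>R y) - t * m y) ` {0..})" for z
  proof (rule bdd_belowI2)
    fix t :: real assume t: "t \<in> {0..}"
    have "t * m y = m (t *\<^sub>R y)"
      using t sublinear_scale[OF m, of t y] sublinear_zero[OF m] by (cases "t = 0") auto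
    also have "\<dots> \<le> m (z + t *\<^sub>R y) + m (- z)"
      using sublinear_add[OF m, of "z + t *\<^sub>R y" "- z"] by simp
    finally show "- m (- z) \<le> m (z + t *\<^sub>R y) - t * m y" by simp
  qed
  have low: "m' y z \<le> m (z + t *\<^sub>R y) - t * m y" if "0 \<le> t" for z t
    unfolding m'_def using bdd that by (intro cINF_lower) auto
  show "m' y z \<le> m z" "m' y z \<le> m (z + y) - m y" using low[of 0] low[of 1] by auto
  show "sublinear (m' y)"
    unfolding sublinear_def
  proof (intro conjI allI impI)
    fix z w
    have pair: "m' y (z + w) \<le> (m (z + s *\<^sub>R y) - s * m y) + (m (w + t *\<^sub>R y) - t * m y)"
      if "0 \<le> s" "0 \<le> t" for s t
    proof -
      have "m' y (z + w) \<le> m ((z + s *\<^sub>R y) + (w + t *\<^sub>R y)) - (s + t) * m y"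
        using low[of "s + t" "z + w"] that by (simp add: algebra_simps)
      then show ?thesis
        using sublinear_add[OF m, of "z + s *\<^sub>R y" "w + t *\<^sub>R y"] by (simp add: algebra_simps)
    qed
    have "m' y (z + w) - m' y w \<le> m (z + s *\<^sub>R y) - s * m y" if s: "0 \<le> s" for s
    proof -
      have "m' y (z + w) - (m (z + s *\<^sub>R y) - s * m y) \<le> m' y w"
        unfolding m'_def[of y w]
      proof (rule cINF_greatest)
        fix t :: real assume "t \<in> {0..}"
        then show "m' y (z + w) - (m (z + s *\<^sub>R y) - s * m y) \<le> m (w + t *\<^sub>R y) - t * m y"
          using pair[OF s, of t] by simp
      qed simp
      then show ?thesis by simp
    qed
    then have "m' y (z + w) - m' y w \<le> m' y z"
      unfolding m'_def[of y z] by (intro cINF_greatest) auto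
    then show "m' y (z + w) \<le> m' y z + m' y w" by simp
  next
    fix r :: real and z assume r: "0 < r"
    have "m' y (r *\<^sub>R z) / r \<le> m' y z"
      unfolding m'_def[of y z]
    proof (rule cINF_greatest)
      fix t :: real assume "t \<in> {0..}"
      then have "m' y (r *\<^sub>R z) \<le> m (r *\<^sub>R (z + t *\<^sub>R y)) - (r * t) * m y"
        using low[of "r * t" "r *\<^sub>R z"] r by (simp add: algebra_simps)
      also have "\<dots> = r * (m (z + t *\<^sub>R y) - t * m y)"
        by (simp only: sublinear_scale[OF m r] right_diff_distrib mult.assoc)
      finally show "m' y (r *\<^sub>R z) / r \<le> m (z + t *\<^sub>R y) - t * m y"
        using r by (simp add: field_simps)
    qed simp
    then show "m' y (r *\<^sub>R z) \<le> r * m' y z" using r by (simp add: field_simps)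
  qed
qed

text \<open>A minimal sublinear functional is linear, because shifting it along any \<open>y\<close> as in
  \<open>sublinear_shift\<close> cannot make it smaller.\<close>

lemma hahn_banach_sublinear:
  fixes N :: "'a::real_vector \<Rightarrow> real"
  assumes N: "sublinear N"
  shows "\<exists>l. linear l \<and> (\<forall>x. l x \<le> N x)"
proof -
  let ?A = "{g. sublinear g \<and> g \<le> N}"
  have "\<exists>m\<in>?A. \<forall>a\<in>?A. m \<ge> a \<longrightarrow> a = m"
  proof (rule predicate_Zorn)
    show "partial_order_on ?A (relation_of (\<ge>) ?A)"
      by (rule partial_order_on_relation_ofI) auto
    fix C assume C: "C \<in> Chains (relation_of (\<ge>) ?A)"
    have CA: "\<And>g. g \<in> C \<Longrightarrow> sublinear g \<and> g \<le> N"
      and ch: "\<And>f g. f \<in> C \<Longrightarrow> g \<in> C \<Longrightarrow> f \<le> g \<or> g \<le> f"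
      using C by (auto simp: Chains_def relation_of_def)
    show "\<exists>u\<in>?A. \<forall>a\<in>C. u \<le> a"
    proof (cases "C = {}")
      case False
      note inf = chain_INF_sublinear[OF False CA ch]
      obtain g where "g \<in> C" using False by blast
      then have "(\<lambda>x. INF g\<in>C. g x) \<le> g" using inf(2) by (simp add: le_fun_def)
      then have "(\<lambda>x. INF g\<in>C. g x) \<le> N" using CA[OF \<open>g \<in> C\<close>] by auto
      then show ?thesis using inf by (intro bexI[of _ "\<lambda>x. INF g\<in>C. g x"]) (auto simp: le_fun_def)
    qed (use N in auto)
  qed
  then obtain m where m: "sublinear m" "m \<le> N"
    and min: "\<And>a. sublinear a \<Longrightarrow> a \<le> N \<Longrightarrow> a \<le> m \<Longrightarrow> a = m" by auto
  have add: "m (z + y) = m z + m y" for y z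
  proof -
    note sh = sublinear_shift[OF m(1), where y = y]
    have "(\<lambda>z. INF t\<in>{0..}. m (z + t *\<^sub>R y) - t * m y) \<le> m" using sh(2) by (simp add: le_fun_def)
    then have "(\<lambda>z. INF t\<in>{0..}. m (z + t *\<^sub>R y) - t * m y) = m"
      using min[OF sh(1)] m(2) by auto
    then have "m z \<le> m (z + y) - m y" using sh(3)[of z] by (metis (no_types, lifting))
    then show ?thesis using sublinear_add[OF m(1), of z y] by simp
  qed
  have neg: "m (- x) = - m x" for x
    using add[of x "- x"] sublinear_zero[OF m(1)] by simp
  have "m (r *\<^sub>R x) = r * m x" for r x
  proof -
    consider "r = 0" | "0 < r" | "0 < - r" by linarith
    then show ?thesis
    proof cases
      case 3
      then show ?thesis using sublinear_scale[OF m(1), of "- r" x] neg[of "r *\<^sub>R x"] by simp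
    qed (use sublinear_zero[OF m(1)] sublinear_scale[OF m(1)] in auto)
  qed
  then have "linear m" using add by (intro linearI) auto
  then show ?thesis using m(2) by (auto simp: le_fun_def)
qed

lemma concave_supergradient_UNIV:
  fixes f :: "'a::real_vector \<Rightarrow> real"
  assumes f: "concave_on UNIV f"
  shows "\<exists>l. linear l \<and> (\<forall>y. f y \<le> f x + l (y - x))"
proof -
  have conc: "u * f y + v * f z \<le> f (u *\<^sub>R y + v *\<^sub>R z)" if "0 \<le> u" "0 \<le> v" "u + v = 1" for u v y z
    using f that by (auto simp: concave_on_iff)
  define D where "D y t = (f x - f (x + t *\<^sub>R y)) / t" for y t
  define N where "N y = (INF t\<in>{0<..}. D y t)" for y
  have D_add: "D (y + z) (s * t / (s + t)) \<le> D y s + D z t" if st: "0 < s" "0 < t" for y z s t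
  proof -
    have "x + (s * t / (s + t)) *\<^sub>R (y + z)
        = (t / (s + t)) *\<^sub>R (x + s *\<^sub>R y) + (s / (s + t)) *\<^sub>R (x + t *\<^sub>R z)"
    proof -
      have "x = (t / (s + t)) *\<^sub>R x + (s / (s + t)) *\<^sub>R x"
        using st by (simp flip: scaleR_add_left add_divide_distrib) (simp add: add.commute)
      then show ?thesis by (simp add: algebra_simps)
    qed
    moreover have "t / (s + t) + s / (s + t) = 1" using st by (simp flip: add_divide_distrib)
    ultimately have "t / (s + t) * f (x + s *\<^sub>R y) + s / (s + t) * f (x + t *\<^sub>R z)
        \<le> f (x + (s * t / (s + t)) *\<^sub>R (y + z))" (is "_ * ?A + _ * ?B \<le> ?F")
      using conc[of "t / (s + t)" "s / (s + t)" "x + s *\<^sub>R y" "x + t *\<^sub>R z"] st by simp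
    moreover have "(c - F) / (s * t / (s + t)) \<le> (c - A) / s + (c - B) / t"
      if "t / (s + t) * A + s / (s + t) * B \<le> F" for A B F c :: real
    proof -
      have "(t * A + s * B) / (s + t) \<le> F" using that by (simp add: add_divide_distrib)
      then have "t * A + s * B \<le> F * (s + t)" using st by (simp add: pos_divide_le_eq)
      then have "(c - F) * (s + t) / (s * t) \<le> (t * (c - A) + s * (c - B)) / (s * t)"
        using st by (intro divide_right_mono) (auto simp: algebra_simps)
      also have "\<dots> = (c - A) / s + (c - B) / t"
        using st by (simp add: add_divide_distrib)
      finally show ?thesis by simp
    qed
    ultimately show ?thesis unfolding D_def by blast
  qed
  have D_scale: "D (r *\<^sub>R y) (t / r) = r * D y t" if "0 < r" "0 < t" for r t y
    using that by (simp add: D_def)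
  have bdd: "bdd_below (D y ` {0<..})" for y
  proof (rule bdd_belowI2)
    fix t :: real assume t: "t \<in> {0<..}"
    have "D (y + (- y)) (t * 1 / (t + 1)) \<le> D y t + D (- y) 1" using t by (intro D_add) auto
    moreover have "D (y + (- y)) (t * 1 / (t + 1)) = 0" by (simp add: D_def)
    ultimately show "- D (- y) 1 \<le> D y t" by simp
  qed
  have low: "N y \<le> D y t" if "0 < t" for y t
    unfolding N_def using bdd that by (intro cINF_lower) auto
  have "sublinear N"
    unfolding sublinear_def
  proof (intro conjI allI impI)
    fix y z
    have "N (y + z) - N z \<le> D y s" if s: "0 < s" for s
    proof -
      have "N (y + z) - D y s \<le> N z"
        unfolding N_def[of z]
      proof (rule cINF_greatest)
        fix t :: real assume t: "t \<in> {0<..}"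
        have "N (y + z) \<le> D (y + z) (s * t / (s + t))" using s t by (intro low) auto
        then show "N (y + z) - D y s \<le> D z t" using D_add[of s t y z] s t by simp
      qed simp
      then show ?thesis by simp
    qed
    then have "N (y + z) - N z \<le> N y" unfolding N_def[of y] by (intro cINF_greatest) auto
    then show "N (y + z) \<le> N y + N z" by simp
  next
    fix r :: real and y assume r: "0 < r"
    have "N (r *\<^sub>R y) / r \<le> N y"
      unfolding N_def[of y]
    proof (rule cINF_greatest)
      fix t :: real assume "t \<in> {0<..}"
      then show "N (r *\<^sub>R y) / r \<le> D y t"
        using low[of "t / r" "r *\<^sub>R y"] D_scale[of r t y] r by (simp add: field_simps)
    qed simp
    then show "N (r *\<^sub>R y) \<le> r * N y" using r by (simp add: field_simps)
  qed
  then obtain l where l: "linear l" "\<And>y. l y \<le> N y" using hahn_banach_sublinear by blast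
  have "f y \<le> f x + - l (y - x)" for y
    using l(2)[of "y - x"] low[of 1 "y - x"] by (simp add: D_def)
  moreover have "linear (\<lambda>y. - l y)" using l(1) by (simp add: linear_compose_neg)
  ultimately show ?thesis by blast
qed

lemma concave_supergradient:
  fixes f :: "'a::real_vector \<Rightarrow> real"
  assumes f: "concave_on S f" and S: "subspace S" and x: "x \<in> S"
  shows "\<exists>l. linear l \<and> (\<forall>y\<in>S. f y \<le> f x + l (y - x))"
proof -
  obtain g where g: "range g \<subseteq> S" "linear g" "\<And>v. v \<in> S \<Longrightarrow> g v = v"
    using linear_exists_left_inverse_on[OF linear_id S] by auto
  have "concave_on UNIV (\<lambda>y. f (g y))"
    using f range_subsetD[OF g(1)]
    by (simp add: concave_on_iff linear_add[OF g(2)] linear_scale[OF g(2)])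
  then obtain l where "linear l" "\<forall>y. f (g y) \<le> f (g x) + l (y - x)"
    using concave_supergradient_UNIV by blast
  then show ?thesis using g(3) x by metis
qed

instantiation "fun" :: (type, real_vector) real_vector
begin

definition scaleR_fun_def: "r *\<^sub>R f = (\<lambda>x. r *\<^sub>R f x)"

instance
  by standard (auto simp: scaleR_fun_def plus_fun_def scaleR_add_left scaleR_add_right)

end

section \<open>Regular projective limits of vector lattices\<close>

locale regular_limit =
  fixes V :: "nat \<Rightarrow> 'v::real_vector set"
    and le :: "nat \<Rightarrow> 'v \<Rightarrow> 'v \<Rightarrow> bool"
    and p :: "nat \<Rightarrow> 'v \<Rightarrow> 'v"
  assumes reg: "regular_proj_system V le p"
begin

abbreviation X :: "(nat \<Rightarrow> 'v) set" where "X \<equiv> plim V p"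

abbreviation ple :: "(nat \<Rightarrow> 'v) \<Rightarrow> (nat \<Rightarrow> 'v) \<Rightarrow> bool" (infix "\<sqsubseteq>" 50) where
  "x \<sqsubseteq> y \<equiv> plim_le le x y"

lemma ordered_vs: "ordered_vs (V n) (le n)"
  and sup_exists: "x \<in> V n \<Longrightarrow> y \<in> V n \<Longrightarrow> \<exists>s. is_sup_in (V n) (le n) {x, y} s"
proof -
  have "vector_lattice (V n) (le n)" using reg unfolding regular_proj_system_def by (elim conjE) (erule spec)
  then show "ordered_vs (V n) (le n)"
    and "x \<in> V n \<Longrightarrow> y \<in> V n \<Longrightarrow> \<exists>s. is_sup_in (V n) (le n) {x, y} s"
    unfolding vector_lattice_def by simp_all
qed

lemma le_refl: "x \<in> V n \<Longrightarrow> le n x x"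
  and le_antisym: "x \<in> V n \<Longrightarrow> y \<in> V n \<Longrightarrow> le n x y \<Longrightarrow> le n y x \<Longrightarrow> x = y"
  and le_trans: "x \<in> V n \<Longrightarrow> y \<in> V n \<Longrightarrow> z \<in> V n \<Longrightarrow> le n x y \<Longrightarrow> le n y z \<Longrightarrow> le n x z"
  and le_add: "x \<in> V n \<Longrightarrow> y \<in> V n \<Longrightarrow> z \<in> V n \<Longrightarrow> le n x y \<Longrightarrow> le n (x + z) (y + z)"
  and le_scale: "x \<in> V n \<Longrightarrow> y \<in> V n \<Longrightarrow> 0 \<le> c \<Longrightarrow> le n x y \<Longrightarrow> le n (c *\<^sub>R x) (c *\<^sub>R y)"
proof -
  note refl = ordered_vs[unfolded ordered_vs_def, of n, THEN conjunct2, THEN conjunct2, THEN conjunct2]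
  note antisym = refl[THEN conjunct2]
  note trans = antisym[THEN conjunct2]
  note add = trans[THEN conjunct2]
  note scale = add[THEN conjunct2]
  show "x \<in> V n \<Longrightarrow> le n x x"
    by (rule refl[THEN conjunct1, THEN bspec])
  show "x \<in> V n \<Longrightarrow> y \<in> V n \<Longrightarrow> le n x y \<Longrightarrow> le n y x \<Longrightarrow> x = y"
    by (intro antisym[THEN conjunct1, THEN bspec, THEN bspec, THEN mp] conjI)
  show "x \<in> V n \<Longrightarrow> y \<in> V n \<Longrightarrow> z \<in> V n \<Longrightarrow> le n x y \<Longrightarrow> le n y z \<Longrightarrow> le n x z"
    by (rule trans[THEN conjunct1, THEN bspec, THEN bspec, THEN bspec, THEN mp, OF _ _ _ conjI])
  show "x \<in> V n \<Longrightarrow> y \<in> V n \<Longrightarrow> z \<in> V n \<Longrightarrow> le n x y \<Longrightarrow> le n (x + z) (y + z)"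
    by (rule add[THEN conjunct1, THEN bspec, THEN bspec, THEN bspec, THEN mp])
  show "x \<in> V n \<Longrightarrow> y \<in> V n \<Longrightarrow> 0 \<le> c \<Longrightarrow> le n x y \<Longrightarrow> le n (c *\<^sub>R x) (c *\<^sub>R y)"
    by (intro scale[THEN bspec, THEN bspec, THEN spec, THEN mp] conjI)
qed

lemma subspace_V: "subspace (V n)"
proof -
  note zero = ordered_vs[unfolded ordered_vs_def, of n]
  note add = zero[THEN conjunct2]
  note scale = add[THEN conjunct2]
  show ?thesis
    by (intro subspaceI zero[THEN conjunct1] add[THEN conjunct1, THEN bspec, THEN bspec]
        scale[THEN conjunct1, THEN bspec, THEN spec])
qed

lemma p_V: "x \<in> V (Suc n) \<Longrightarrow> p n x \<in> V n"
  and p_add: "x \<in> V (Suc n) \<Longrightarrow> y \<in> V (Suc n) \<Longrightarrow> p n (x + y) = p n x + p n y"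
  and p_scale: "x \<in> V (Suc n) \<Longrightarrow> p n (c *\<^sub>R x) = c *\<^sub>R p n x"
  and p_pos: "x \<in> V (Suc n) \<Longrightarrow> le (Suc n) 0 x \<Longrightarrow> le n 0 (p n x)"
  and p_sup: "finite A \<Longrightarrow> A \<noteq> {} \<Longrightarrow> A \<subseteq> V (Suc n) \<Longrightarrow> is_sup_in (V (Suc n)) (le (Suc n)) A s
    \<Longrightarrow> is_sup_in (V n) (le n) (p n ` A) (p n s)"
proof -
  note pn = reg[unfolded regular_proj_system_def, THEN conjunct2, THEN spec, of n]
  note add = pn[THEN conjunct2]
  note scale = add[THEN conjunct2]
  note pos = scale[THEN conjunct2]
  note sup = pos[THEN conjunct2]
  show "x \<in> V (Suc n) \<Longrightarrow> p n x \<in> V n"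
    by (rule subsetD[OF pn[THEN conjunct1] imageI])
  show "x \<in> V (Suc n) \<Longrightarrow> y \<in> V (Suc n) \<Longrightarrow> p n (x + y) = p n x + p n y"
    by (rule add[THEN conjunct1, THEN bspec, THEN bspec])
  show "x \<in> V (Suc n) \<Longrightarrow> p n (c *\<^sub>R x) = c *\<^sub>R p n x"
    by (rule scale[THEN conjunct1, THEN bspec, THEN spec])
  show "x \<in> V (Suc n) \<Longrightarrow> le (Suc n) 0 x \<Longrightarrow> le n 0 (p n x)"
    by (rule pos[THEN conjunct1, THEN bspec, THEN mp])
  show "finite A \<Longrightarrow> A \<noteq> {} \<Longrightarrow> A \<subseteq> V (Suc n) \<Longrightarrow> is_sup_in (V (Suc n)) (le (Suc n)) A s
      \<Longrightarrow> is_sup_in (V n) (le n) (p n ` A) (p n s)"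
    by (intro sup[THEN spec, THEN spec, THEN mp] conjI)
qed

lemma X_V: "x \<in> X \<Longrightarrow> x n \<in> V n"
  and X_p: "x \<in> X \<Longrightarrow> p n (x (Suc n)) = x n"
  unfolding plim_def mem_Collect_eq by (drule spec[of _ n], erule conjunct1, drule spec[of _ n], erule sym[OF conjunct2])

lemma X_I:
  assumes "\<And>n. x n \<in> V n" "\<And>n. p n (x (Suc n)) = x n"
  shows "x \<in> X"
  unfolding plim_def mem_Collect_eq by (intro allI conjI assms assms(2)[symmetric])

lemma subspace_X: "subspace X"
proof (rule subspaceI)
  have "p n (0 *\<^sub>R 0) = 0 *\<^sub>R p n 0" for n
    using subspace_0[OF subspace_V] by (rule p_scale)
  then show "0 \<in> X" using subspace_0[OF subspace_V] by (intro X_I) auto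
next
  fix x y assume "x \<in> X" "y \<in> X"
  note this[THEN X_V] this[THEN X_p]
  then show "x + y \<in> X"
    by (intro X_I) (simp_all add: p_add subspace_add[OF subspace_V])
next
  fix c x assume "x \<in> X"
  note X_V[OF this] X_p[OF this]
  then show "c *\<^sub>R x \<in> X"
    by (intro X_I) (simp_all add: p_scale subspace_scale[OF subspace_V] scaleR_fun_def)
qed

lemma ple_refl: "x \<in> X \<Longrightarrow> x \<sqsubseteq> x"
  unfolding plim_le_def using le_refl[OF X_V[of x]] by simp

lemma ple_antisym:
  assumes "x \<in> X" "y \<in> X" "x \<sqsubseteq> y" "y \<sqsubseteq> x"
  shows "x = y"
proof
  fix n
  have "le n (x n) (y n)" "le n (y n) (x n)" using assms(3,4) by (simp_all add: plim_le_def)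
  with X_V[OF assms(1)] X_V[OF assms(2)] show "x n = y n" by (rule le_antisym)
qed

lemma ple_trans:
  assumes "x \<in> X" "y \<in> X" "z \<in> X" "x \<sqsubseteq> y" "y \<sqsubseteq> z"
  shows "x \<sqsubseteq> z"
  unfolding plim_le_def
proof
  fix n
  have "le n (x n) (y n)" "le n (y n) (z n)" using assms(4,5) by (simp_all add: plim_le_def)
  with assms(1-3)[THEN X_V] show "le n (x n) (z n)" by (rule le_trans)
qed

lemma p_mono:
  assumes "x \<in> V (Suc n)" "y \<in> V (Suc n)" "le (Suc n) x y"
  shows "le n (p n x) (p n y)"
proof -
  have d: "y - x \<in> V (Suc n)" using assms subspace_diff[OF subspace_V] by blast
  have "le (Suc n) (x + - x) (y + - x)"
    using assms subspace_neg[OF subspace_V] by (intro le_add) auto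
  then have "le n (0 + p n x) (p n (y - x) + p n x)"
    using assms d p_pos subspace_0[OF subspace_V] by (intro le_add p_V) auto
  then show ?thesis using p_add[OF d assms(1)] by simp
qed

lemma coord_mono:
  assumes x: "x \<in> X" and y: "y \<in> X" and "j \<le> k" "le k (x k) (y k)"
  shows "le j (x j) (y j)"
  using assms(3,4)
proof (induction rule: inc_induct)
  case (step n)
  show ?case using p_mono[OF X_V[OF x] X_V[OF y] step.IH[OF step.prems]] by (simp add: X_p[OF x] X_p[OF y])
qed

lemma join_exists:
  assumes x: "x \<in> X" and y: "y \<in> X"
  shows "\<exists>s\<in>X. \<forall>n. is_sup_in (V n) (le n) {x n, y n} (s n)"
proof -
  have ex: "\<exists>s. is_sup_in (V n) (le n) {x n, y n} s" for n
    by (rule sup_exists[OF X_V[OF x] X_V[OF y]])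
  define s where "s n = (SOME s. is_sup_in (V n) (le n) {x n, y n} s)" for n
  have s: "is_sup_in (V n) (le n) {x n, y n} (s n)" for n
    unfolding s_def by (rule someI_ex[OF ex])
  have "p n (s (Suc n)) = s n" for n
  proof -
    have "is_sup_in (V n) (le n) (p n ` {x (Suc n), y (Suc n)}) (p n (s (Suc n)))"
      by (rule p_sup[OF _ _ _ s]) (use X_V[OF x] X_V[OF y] in auto)
    then have "is_sup_in (V n) (le n) {x n, y n} (p n (s (Suc n)))"
      by (simp add: X_p[OF x] X_p[OF y])
    with s[of n] show ?thesis
      unfolding is_sup_in_def by (metis le_antisym)
  qed
  then have "s \<in> X" using s by (intro X_I) (auto simp: is_sup_in_def)
  then show ?thesis using s by blast
qed

definition join :: "(nat \<Rightarrow> 'v) \<Rightarrow> (nat \<Rightarrow> 'v) \<Rightarrow> nat \<Rightarrow> 'v" where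
  "join x y = (SOME s. s \<in> X \<and> (\<forall>n. is_sup_in (V n) (le n) {x n, y n} (s n)))"

lemma
  assumes "x \<in> X" "y \<in> X"
  shows join_X: "join x y \<in> X"
    and join_coord: "is_sup_in (V n) (le n) {x n, y n} (join x y n)"
proof -
  have "join x y \<in> X \<and> (\<forall>n. is_sup_in (V n) (le n) {x n, y n} (join x y n))"
    using someI_ex[OF join_exists[OF assms, unfolded Bex_def]] unfolding join_def .
  then show "join x y \<in> X" "is_sup_in (V n) (le n) {x n, y n} (join x y n)" by simp_all
qed

lemma
  assumes "x \<in> X" "y \<in> X"
  shows join_ge1: "x \<sqsubseteq> join x y" and join_ge2: "y \<sqsubseteq> join x y"
    and join_least: "\<And>u. u \<in> X \<Longrightarrow> x \<sqsubseteq> u \<Longrightarrow> y \<sqsubseteq> u \<Longrightarrow> join x y \<sqsubseteq> u"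
proof -
  show "x \<sqsubseteq> join x y" "y \<sqsubseteq> join x y"
    using join_coord[OF assms] by (simp_all add: plim_le_def is_sup_in_def)
  show "join x y \<sqsubseteq> u" if "u \<in> X" "x \<sqsubseteq> u" "y \<sqsubseteq> u" for u
    using join_coord[OF assms] X_V[OF that(1)] that(2,3) by (simp add: plim_le_def is_sup_in_def)
qed

lemma join_eq_left:
  assumes "x \<in> X" "y \<in> X" "le n (y n) (x n)"
  shows "join x y n = x n"
  using join_coord[OF assms(1,2), of n] assms(3) X_V[OF assms(1), of n] le_refl[of "x n" n]
  by (intro le_antisym[of _ n]) (simp_all add: is_sup_in_def)

lemma lower_bound_exists:
  assumes x: "x \<in> X" and y: "y \<in> X"
  shows "\<exists>a\<in>X. a \<sqsubseteq> x \<and> a \<sqsubseteq> y"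
proof
  let ?a = "x + y - join x y"
  note X = x y join_X[OF x y]
  show a: "?a \<in> X" by (intro subspace_diff[OF subspace_X] subspace_add[OF subspace_X] X)
  have "le n (?a n) (x n)" "le n (?a n) (y n)" for n
  proof -
    note V = X[THEN X_V, of n]
    have "le n (x n) (join x y n)" "le n (y n) (join x y n)"
      using join_coord[OF x y, of n] by (simp_all add: is_sup_in_def)
    then have "le n (y n + (x n - join x y n)) (join x y n + (x n - join x y n))"
      "le n (x n + (y n - join x y n)) (join x y n + (y n - join x y n))"
      using V by (intro le_add subspace_diff[OF subspace_V]; simp)+
    then show "le n (?a n) (x n)" "le n (?a n) (y n)" by (simp_all add: algebra_simps)
  qed
  then show "?a \<sqsubseteq> x \<and> ?a \<sqsubseteq> y" by (simp add: plim_le_def)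
qed

text \<open>The bound has \<open>j\<close>-th coordinate \<open>x\<^sub>j \<or> h\<^sub>n\<^sub>,\<^sub>j \<or> \<dots> \<or> h\<^sub>j\<^sub>-\<^sub>1\<^sub>,\<^sub>j\<close>; it is compatible with the
  projections because these preserve joins and the term \<open>h\<^sub>j\<close> is absorbed by \<open>x\<close> at level \<open>j\<close>.\<close>

lemma diagonal_upper_bound:
  assumes h: "\<And>k. h k \<in> X" and x: "x \<in> X" and hx: "\<And>k. le k (h k k) (x k)"
  shows "\<exists>b\<in>X. (\<forall>k\<ge>n. h k \<sqsubseteq> b) \<and> b n = x n"
proof -
  define B where "B = rec_nat x (\<lambda>m z. if n \<le> m then join z (h m) else z)"
  have B_0: "B 0 = x" and B_Suc: "B (Suc m) = (if n \<le> m then join (B m) (h m) else B m)" for m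
    by (auto simp: B_def)
  have B_X: "B m \<in> X" for m
    by (induction m) (auto simp: B_0 B_Suc x h join_X)
  have B_mono: "B m \<sqsubseteq> B k" if "m \<le> k" for m k
    using that
  proof (induction rule: dec_induct)
    case (step k)
    then show ?case
      using B_X h by (auto simp: B_Suc intro: ple_trans[OF _ _ _ _ join_ge1] join_X)
  qed (simp add: ple_refl B_X)
  have x_B: "le j (x j) (B m j)" for j m
    using B_mono[of 0 m] by (simp add: B_0 plim_le_def)
  have h_B: "le j (h k j) (B m j)" if "j \<le> k" for j k m
    using coord_mono[OF h x that hx] x_B by (rule le_trans[rotated 3]) (simp_all add: X_V[OF x] X_V[OF h] X_V[OF B_X])
  define b where "b j = B j j" for j
  have "p j (b (Suc j)) = b j" for j
  proof -
    have "B (Suc j) j = B j j"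
      using h_B[of j j j] by (simp add: B_Suc join_eq_left B_X h)
    then show ?thesis by (simp add: b_def X_p[OF B_X])
  qed
  then have b_X: "b \<in> X" by (intro X_I) (auto simp: b_def X_V[OF B_X])
  have "le j (h k j) (b j)" if "n \<le> k" for k j
  proof (cases "j \<le> k")
    case True
    then show ?thesis unfolding b_def by (rule h_B)
  next
    case False
    have "h k \<sqsubseteq> B (Suc k)" using that by (simp add: B_Suc join_ge2 B_X h)
    moreover have "B (Suc k) \<sqsubseteq> B j" using False by (intro B_mono) auto
    ultimately show ?thesis using ple_trans[OF h B_X B_X] by (simp add: b_def plim_le_def)
  qed
  moreover have "B m = x" if "m \<le> n" for m
    using that by (induction m) (auto simp: B_0 B_Suc)
  ultimately show ?thesis using b_X by (intro bexI[of _ b]) (auto simp: plim_le_def b_def)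
qed

lemma le_cmb:
  assumes "x \<in> X" "y \<in> X" "x' \<in> X" "y' \<in> X" "le n (x n) (x' n)" "le n (y n) (y' n)"
    and t: "t \<in> {0..1::real}"
  shows "le n (cmb t x y n) (cmb t x' y' n)"
proof -
  note xV = assms(1-4)[THEN X_V, of n]
  have V: "t *\<^sub>R x n \<in> V n" "t *\<^sub>R x' n \<in> V n" "(1 - t) *\<^sub>R y n \<in> V n" "(1 - t) *\<^sub>R y' n \<in> V n"
    using xV by (auto intro!: subspace_scale[OF subspace_V])
  have "le n (t *\<^sub>R x n + (1 - t) *\<^sub>R y n) (t *\<^sub>R x' n + (1 - t) *\<^sub>R y n)"
    using assms(5-) V xV by (intro le_add le_scale) auto
  moreover have "le n ((1 - t) *\<^sub>R y n + t *\<^sub>R x' n) ((1 - t) *\<^sub>R y' n + t *\<^sub>R x' n)"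
    using assms(5-) V xV by (intro le_add le_scale) auto
  ultimately show ?thesis
    unfolding cmb_def add.commute[of "(1 - t) *\<^sub>R _"]
    by (rule le_trans[rotated 3]) (use V in \<open>auto intro: subspace_add[OF subspace_V]\<close>)
qed

lemma cmb_eq: "cmb t x y = t *\<^sub>R x + (1 - t) *\<^sub>R (y :: nat \<Rightarrow> 'v)"
  by (rule ext) (simp add: cmb_def scaleR_fun_def)

lemma cmb_X: "x \<in> X \<Longrightarrow> y \<in> X \<Longrightarrow> cmb t x y \<in> X"
  unfolding cmb_eq by (intro subspace_add[OF subspace_X] subspace_scale[OF subspace_X])

end

section \<open>Infima of sequences in \<open>H\<close>\<close>

locale order_closed_limit = regular_limit V le p
  for V :: "nat \<Rightarrow> 'v::real_vector set" and le p +
  fixes q1 :: "'v \<Rightarrow> real" and H :: "(nat \<Rightarrow> 'v) set"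
  assumes q1_incr: "\<lbrakk>a \<in> V 0; b \<in> V 0; le 0 a b\<rbrakk> \<Longrightarrow> q1 a \<le> q1 b"
    and q1_concave: "\<lbrakk>a \<in> V 0; b \<in> V 0; t \<in> {0..1::real}\<rbrakk>
      \<Longrightarrow> t * q1 a + (1 - t) * q1 b \<le> q1 (t *\<^sub>R a + (1 - t) *\<^sub>R b)"
    and H_sub: "H \<subseteq> X"
    and H_convex: "\<lbrakk>h \<in> H; h' \<in> H; t \<in> {0..1::real}\<rbrakk> \<Longrightarrow> cmb t h h' \<in> H"
    and decreasing: "(\<forall>k. hs k \<in> H) \<Longrightarrow> (\<forall>k. hs (Suc k) \<sqsubseteq> hs k) \<Longrightarrow>
        bdd_below (range (\<lambda>k. q1 (hs k 0))) \<Longrightarrow>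
        (\<exists>b\<in>X. \<forall>k. b \<sqsubseteq> hs k) \<and>
        (\<forall>m. is_inf_in X (plim_le le) (range hs) m \<longrightarrow> (INF k. q1 (hs k 0)) \<le> q1 (m 0))"
    and limsup: "(\<forall>k. hs k \<in> H) \<Longrightarrow>
        (\<exists>a\<in>X. \<exists>b\<in>X. \<forall>k. a \<sqsubseteq> hs k \<and> hs k \<sqsubseteq> b) \<Longrightarrow>
        (\<exists>s. (\<forall>n. is_sup_in X (plim_le le) (hs ` {n..}) (s n)) \<and>
             (\<exists>l. is_inf_in X (plim_le le) (range s) l \<and> l \<in> H))"
begin

lemma H_X: "h \<in> H \<Longrightarrow> h \<in> X"
  using H_sub by blast

lemma sup_in_H:
  fixes hs :: "nat \<Rightarrow> nat \<Rightarrow> 'v"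
  assumes hs: "\<And>k. hs k \<in> H" and a: "a \<in> X" "\<And>k. a \<sqsubseteq> hs k" and b: "b \<in> X" "\<And>k. hs k \<sqsubseteq> b"
    and tail: "\<And>n u k. u \<in> X \<Longrightarrow> (\<And>k. n \<le> k \<Longrightarrow> hs k \<sqsubseteq> u) \<Longrightarrow> hs k \<sqsubseteq> u"
  shows "\<exists>l\<in>H. is_sup_in X (plim_le le) (range hs) l"
proof -
  obtain s l where s: "\<And>n. is_sup_in X (plim_le le) (hs ` {n..}) (s n)"
    and l: "is_inf_in X (plim_le le) (range s) l" "l \<in> H"
    using limsup[of hs] hs a b by meson
  have s_X: "s n \<in> X" and s_ub: "\<And>k. n \<le> k \<Longrightarrow> hs k \<sqsubseteq> s n" for n
    using s[of n] by (simp_all add: is_sup_in_def)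
  have "hs k \<sqsubseteq> s n" for k n by (rule tail[OF s_X s_ub])
  then have "hs k \<sqsubseteq> l" for k
    using l(1) H_X[OF hs] by (simp add: is_inf_in_def)
  moreover have "l \<sqsubseteq> u" if u: "u \<in> X" "\<And>k. hs k \<sqsubseteq> u" for u
  proof (rule ple_trans[OF H_X[OF l(2)] s_X u(1)])
    show "l \<sqsubseteq> s 0" using l(1) by (simp add: is_inf_in_def)
    show "s 0 \<sqsubseteq> u" using s[of 0] u by (simp add: is_sup_in_def)
  qed
  ultimately show ?thesis using l(2) H_X by (intro bexI[of _ l]) (auto simp: is_sup_in_def)
qed

lemma pair_sup_in_H:
  assumes x: "x \<in> H" and y: "y \<in> H"
  shows "\<exists>l\<in>H. is_sup_in X (plim_le le) {x, y} l"
proof -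
  note X = H_X[OF x] H_X[OF y]
  let ?hs = "\<lambda>k::nat. if even k then x else y"
  obtain a where a: "a \<in> X" "a \<sqsubseteq> x" "a \<sqsubseteq> y" using lower_bound_exists[OF X] by blast
  have "\<exists>l\<in>H. is_sup_in X (plim_le le) (range ?hs) l"
  proof (rule sup_in_H[of _ a "join x y"])
    show "?hs k \<sqsubseteq> u" if u: "\<And>k. n \<le> k \<Longrightarrow> ?hs k \<sqsubseteq> u" for n k u
      using u[of "2 * n"] u[of "Suc (2 * n)"] by simp
  qed (use x y a join_X[OF X] join_ge1[OF X] join_ge2[OF X] in simp_all)
  moreover have "range ?hs = {x, y}"
    using rangeI[of ?hs 0] rangeI[of ?hs 1] by auto
  ultimately show ?thesis by simp
qed

lemma incseq_sup_in_H:
  assumes hs: "\<And>k. hs k \<in> H" and inc: "\<And>k. hs k \<sqsubseteq> hs (Suc k)" and b: "b \<in> X" "\<And>k. hs k \<sqsubseteq> b"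
  shows "\<exists>l\<in>H. is_sup_in X (plim_le le) (range hs) l"
proof (rule sup_in_H)
  have mono: "hs k \<sqsubseteq> hs m" if "k \<le> m" for k m
    using that
  proof (induction rule: dec_induct)
    case (step m)
    show ?case by (rule ple_trans[OF H_X[OF hs] H_X[OF hs] H_X[OF hs] step.IH inc])
  qed (rule ple_refl[OF H_X[OF hs]])
  then show "hs 0 \<sqsubseteq> hs k" for k by simp
  show "hs k \<sqsubseteq> u" if u: "u \<in> X" "\<And>k. n \<le> k \<Longrightarrow> hs k \<sqsubseteq> u" for n u k
    using ple_trans[OF H_X[OF hs] H_X[OF hs] u(1) mono u(2)] by (metis max.cobounded1 max.cobounded2)
qed (use hs b H_X in auto)

lemma seq_sup_in_H:
  fixes h :: "nat \<Rightarrow> nat \<Rightarrow> 'v"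
  assumes h: "\<And>k. h k \<in> H" and b: "b \<in> X" "\<And>k. h k \<sqsubseteq> b"
  shows "\<exists>l\<in>H. is_sup_in X (plim_le le) (range h) l"
proof -
  have "\<forall>x y. \<exists>l. x \<in> H \<longrightarrow> y \<in> H \<longrightarrow> l \<in> H \<and> is_sup_in X (plim_le le) {x, y} l"
    using pair_sup_in_H by meson
  then obtain J where "\<forall>x y. x \<in> H \<longrightarrow> y \<in> H \<longrightarrow> J x y \<in> H \<and> is_sup_in X (plim_le le) {x, y} (J x y)"
    by metis
  then have J_H: "J x y \<in> H" and J_ge: "x \<sqsubseteq> J x y" "y \<sqsubseteq> J x y"
    and J_least: "\<And>u. u \<in> X \<Longrightarrow> x \<sqsubseteq> u \<Longrightarrow> y \<sqsubseteq> u \<Longrightarrow> J x y \<sqsubseteq> u"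
    if "x \<in> H" "y \<in> H" for x y
    using that by (auto simp: is_sup_in_def)
  define G where "G = rec_nat (h 0) (\<lambda>m g. J g (h (Suc m)))"
  have G_0: "G 0 = h 0" and G_Suc: "G (Suc m) = J (G m) (h (Suc m))" for m
    by (simp_all add: G_def)
  have G_H: "G m \<in> H" for m by (induction m) (simp_all add: G_0 G_Suc h J_H)
  have G_least: "G m \<sqsubseteq> u" if "u \<in> X" "\<And>k. h k \<sqsubseteq> u" for m u
    by (induction m) (simp_all add: G_0 G_Suc h that J_least G_H)
  have h_G: "h m \<sqsubseteq> G m" for m
    by (cases m) (simp_all add: G_0 G_Suc J_ge h G_H ple_refl[OF H_X])
  obtain l where l: "l \<in> H" "is_sup_in X (plim_le le) (range G) l"
    using incseq_sup_in_H[of G b] G_H b G_least by (auto simp: G_Suc J_ge h)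
  have "h m \<sqsubseteq> l" for m
    using ple_trans[OF H_X[OF h] H_X[OF G_H] H_X[OF l(1)] h_G] l(2) by (simp add: is_sup_in_def)
  then have "is_sup_in X (plim_le le) (range h) l"
    using l(2) G_least by (simp add: is_sup_in_def)
  then show ?thesis using l(1) by blast
qed

lemma decseq_lower_bound_in_H:
  assumes hs: "\<And>k. hs k \<in> H" and dec: "\<And>k. hs (Suc k) \<sqsubseteq> hs k" and c: "\<And>k. c \<le> q1 (hs k 0)"
  shows "\<exists>l\<in>H. (\<forall>k. l \<sqsubseteq> hs k) \<and> c \<le> q1 (l 0)"
proof -
  have mono: "hs m \<sqsubseteq> hs k" if "k \<le> m" for k m
    using that
  proof (induction rule: dec_induct)
    case (step m)
    show ?case by (rule ple_trans[OF H_X[OF hs] H_X[OF hs] H_X[OF hs] dec step.IH])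
  qed (rule ple_refl[OF H_X[OF hs]])
  have bdd: "bdd_below (range (\<lambda>k. q1 (hs k 0)))" using c by (intro bdd_belowI2)
  obtain b where b: "b \<in> X" "\<And>k. b \<sqsubseteq> hs k"
    and q_inf: "\<And>m. is_inf_in X (plim_le le) (range hs) m \<Longrightarrow> (INF k. q1 (hs k 0)) \<le> q1 (m 0)"
    using decreasing[of hs] hs dec bdd by blast
  obtain s l where s: "\<And>n. is_sup_in X (plim_le le) (hs ` {n..}) (s n)"
    and l: "is_inf_in X (plim_le le) (range s) l" "l \<in> H"
    using limsup[of hs] hs b H_X[OF hs, of 0] mono[of 0] by (meson zero_le)
  have "s n = hs n" for n
    by (rule ple_antisym) (use s[of n] mono H_X[OF hs] in \<open>simp_all add: is_sup_in_def\<close>)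
  then have inf: "is_inf_in X (plim_le le) (range hs) l" using l(1) by simp
  have "c \<le> (INF k. q1 (hs k 0))" using c by (intro cINF_greatest) auto
  then show ?thesis using q_inf[OF inf] inf l(2) by (intro bexI[of _ l]) (auto simp: is_inf_in_def)
qed

lemma diagonal_lower_bound_in_H:
  assumes h: "\<And>k. h k \<in> H" and x: "x \<in> X" and hx: "\<And>k. le k (h k k) (x k)"
    and c: "\<And>k. c \<le> q1 (h k 0)"
  shows "\<exists>l\<in>H. l \<sqsubseteq> x \<and> c \<le> q1 (l 0)"
proof -
  have "\<exists>l\<in>H. is_sup_in X (plim_le le) (range (\<lambda>k. h (n + k))) l \<and> le n (l n) (x n)" for n
  proof -
    obtain b where b: "b \<in> X" "\<And>k. n \<le> k \<Longrightarrow> h k \<sqsubseteq> b" "b n = x n"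
      using diagonal_upper_bound[OF H_X[OF h] x hx] by blast
    then obtain l where l: "l \<in> H" "is_sup_in X (plim_le le) (range (\<lambda>k. h (n + k))) l"
      using seq_sup_in_H[of "\<lambda>k. h (n + k)" b] h by auto
    then have "l \<sqsubseteq> b" using b by (simp add: is_sup_in_def)
    then have "le n (l n) (x n)" using b(3) by (metis plim_le_def)
    then show ?thesis using l by blast
  qed
  then obtain s where s_H: "\<And>n. s n \<in> H" and s: "\<And>n. is_sup_in X (plim_le le) (range (\<lambda>k. h (n + k))) (s n)"
    and s_x: "\<And>n. le n (s n n) (x n)" by metis
  have h_s: "h (n + k) \<sqsubseteq> s n" for n k using s[of n] by (simp add: is_sup_in_def)
  have "s (Suc n) \<sqsubseteq> s n" for n
    using s[of "Suc n"] h_s[of n "Suc _"] H_X[OF s_H] by (simp add: is_sup_in_def)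
  moreover have "c \<le> q1 (s n 0)" for n
  proof -
    have "le 0 (h n 0) (s n 0)" using h_s[of n 0] by (simp add: plim_le_def)
    then show ?thesis using q1_incr[OF X_V[OF H_X[OF h]] X_V[OF H_X[OF s_H]]] c[of n] by (meson order_trans)
  qed
  ultimately obtain l where l: "l \<in> H" "\<And>k. l \<sqsubseteq> s k" "c \<le> q1 (l 0)"
    using decseq_lower_bound_in_H[of s c] s_H by blast
  have "le n (l n) (x n)" for n
    using le_trans[OF X_V[OF H_X[OF l(1)]] X_V[OF H_X[OF s_H]] X_V[OF x] _ s_x] l(2)[of n]
    by (simp add: plim_le_def)
  then show ?thesis using l by (auto simp: plim_le_def)
qed

end

section \<open>The supremal function\<close>

locale minorized_limit = order_closed_limit V le p q1 H
  for V :: "nat \<Rightarrow> 'v::real_vector set" and le p q1 H +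
  fixes Y :: "(nat \<Rightarrow> 'v) set"
  assumes Y_sub: "Y \<subseteq> X" and subspace_Y: "subspace Y"
    and minorizing: "y \<in> Y \<Longrightarrow> \<exists>h\<in>H. le n (h n) (y n)"
begin

lemma Y_X: "x \<in> Y \<Longrightarrow> x \<in> X"
  using Y_sub by blast

abbreviation F :: "(nat \<Rightarrow> 'v) \<Rightarrow> ereal" where
  "F x \<equiv> spf H (plim_le le) (\<lambda>h. q1 (h 0)) x"

definition S :: "nat \<Rightarrow> (nat \<Rightarrow> 'v) \<Rightarrow> real" where
  "S n x = (SUP h\<in>{h \<in> H. le n (h n) (x n)}. q1 (h 0))"

lemma q1_cmb:
  assumes "h \<in> X" "h' \<in> X" "t \<in> {0..1}"
  shows "t * q1 (h 0) + (1 - t) * q1 (h' 0) \<le> q1 (cmb t h h' 0)"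
  using q1_concave[OF X_V[OF assms(1)] X_V[OF assms(2)] assms(3)] by (simp add: cmb_def)

lemma q1_le:
  assumes "h \<in> H" "x \<in> X" "le n (h n) (x n)"
  shows "q1 (h 0) \<le> q1 (x 0)"
  using coord_mono[OF H_X[OF assms(1)] assms(2) _ assms(3), of 0]
  by (intro q1_incr X_V[OF assms(2)] X_V[OF H_X[OF assms(1)]]) simp

lemma S_upper:
  assumes "h \<in> H" "x \<in> X" "le n (h n) (x n)"
  shows "q1 (h 0) \<le> S n x"
  unfolding S_def
proof (rule cSUP_upper)
  show "bdd_above ((\<lambda>h. q1 (h 0)) ` {h \<in> H. le n (h n) (x n)})"
    using q1_le[OF _ assms(2)] by (intro bdd_aboveI2) auto
qed (use assms in simp)

lemma S_least:
  assumes "x \<in> Y" "\<And>h. h \<in> H \<Longrightarrow> le n (h n) (x n) \<Longrightarrow> q1 (h 0) \<le> c"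
  shows "S n x \<le> c"
  unfolding S_def
  by (rule cSUP_least) (use assms minorizing[OF assms(1), of n] in auto)

lemma S_cmb:
  assumes x: "x \<in> Y" and y: "y \<in> Y" and t: "0 < t" "t < 1"
  shows "t * S n x + (1 - t) * S n y \<le> S n (cmb t x y)"
proof -
  have pair: "t * q1 (h 0) + (1 - t) * q1 (h' 0) \<le> S n (cmb t x y)"
    if h: "h \<in> H" "le n (h n) (x n)" and h': "h' \<in> H" "le n (h' n) (y n)" for h h'
  proof -
    have "le n (cmb t h h' n) (cmb t x y n)"
      using t by (intro le_cmb H_X h h' Y_X x y) auto
    then have "q1 (cmb t h h' 0) \<le> S n (cmb t x y)"
      using t by (intro S_upper H_convex cmb_X Y_X x y h h') auto
    then show ?thesis using q1_cmb[OF H_X[OF h(1)] H_X[OF h'(1)], of t] t by simp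
  qed
  have "S n y \<le> (S n (cmb t x y) - t * S n x) / (1 - t)"
  proof (rule S_least[OF y])
    fix h' assume h': "h' \<in> H" "le n (h' n) (y n)"
    have "S n x \<le> (S n (cmb t x y) - (1 - t) * q1 (h' 0)) / t"
    proof (rule S_least[OF x])
      fix h assume "h \<in> H" "le n (h n) (x n)"
      from pair[OF this h'] show "q1 (h 0) \<le> (S n (cmb t x y) - (1 - t) * q1 (h' 0)) / t"
        using t by (simp add: pos_le_divide_eq mult.commute)
    qed
    then show "q1 (h' 0) \<le> (S n (cmb t x y) - t * S n x) / (1 - t)"
      using t by (simp add: pos_le_divide_eq mult.commute)
  qed
  then show ?thesis using t by (simp add: pos_le_divide_eq mult.commute)
qed

lemma concave_S: "concave_on Y (S n)"
  unfolding concave_on_iff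
proof (intro conjI ballI allI impI)
  show "convex Y" by (rule subspace_imp_convex[OF subspace_Y])
  fix x y and u v :: real
  assume "x \<in> Y" "y \<in> Y" "0 \<le> u" "0 \<le> v" "u + v = 1"
  then have v: "v = 1 - u" and "u = 0 \<or> u = 1 \<or> 0 < u \<and> u < 1" by auto
  then consider "u = 0" | "u = 1" | "0 < u" "u < 1" by blast
  then show "u * S n x + v * S n y \<le> S n (u *\<^sub>R x + v *\<^sub>R y)"
    by cases (use S_cmb[OF \<open>x \<in> Y\<close> \<open>y \<in> Y\<close>, of u n] in \<open>simp_all add: v cmb_eq\<close>)
qed

lemma F_upper: "h \<in> H \<Longrightarrow> h \<sqsubseteq> x \<Longrightarrow> ereal (q1 (h 0)) \<le> F x"
  unfolding spf_def by (rule Sup_upper) simp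

lemma F_le: "(\<And>h. h \<in> H \<Longrightarrow> h \<sqsubseteq> x \<Longrightarrow> ereal (q1 (h 0)) \<le> c) \<Longrightarrow> F x \<le> c"
  unfolding spf_def by (rule Sup_least) auto

lemma F_not_PInf:
  assumes "x \<in> X"
  shows "F x \<noteq> \<infinity>"
proof -
  have "F x \<le> ereal (q1 (x 0))"
    using q1_le[OF _ assms] by (intro F_le) (auto simp: plim_le_def)
  then show ?thesis by auto
qed

lemma F_cmb:
  assumes x: "x \<in> X" and y: "y \<in> X" and t: "t \<in> {0..1::real}"
  shows "ereal t * F x + ereal (1 - t) * F y \<le> F (cmb t x y)"
proof -
  have pair: "ereal (t * q1 (h 0) + (1 - t) * q1 (h' 0)) \<le> F (cmb t x y)"
    if h: "h \<in> H" "h \<sqsubseteq> x" and h': "h' \<in> H" "h' \<sqsubseteq> y" for h h'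
  proof -
    have "cmb t h h' \<sqsubseteq> cmb t x y"
      using h h' by (auto simp: plim_le_def intro!: le_cmb H_X x y t)
    then have "ereal (q1 (cmb t h h' 0)) \<le> F (cmb t x y)"
      by (intro F_upper H_convex h h' t)
    then show ?thesis
      using q1_cmb[OF H_X[OF h(1)] H_X[OF h'(1)] t] by (meson ereal_less_eq(3) order_trans)
  qed
  consider "t = 0" | "t = 1" | "0 < t" "t < 1" using t by fastforce
  then show ?thesis
  proof cases
    case 3
    show ?thesis
    proof (cases "F x = - \<infinity> \<or> F y = - \<infinity>")
      case True
      then have "ereal t * F x + ereal (1 - t) * F y = - \<infinity>"
        using 3 F_not_PInf[OF x] F_not_PInf[OF y] by (cases "F x"; cases "F y") auto
      then show ?thesis by (rule ord_eq_le_trans) simp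
    next
      case False
      then obtain a b where ab: "F x = ereal a" "F y = ereal b"
        using F_not_PInf[OF x] F_not_PInf[OF y] by (cases "F x"; cases "F y") auto
      obtain h h' where h: "h \<in> H" "h \<sqsubseteq> x" "h' \<in> H" "h' \<sqsubseteq> y"
        using False F_le[of x "- \<infinity>"] F_le[of y "- \<infinity>"] by fastforce
      obtain c where c: "F (cmb t x y) = ereal c"
        using pair[OF h] F_not_PInf[OF cmb_X[OF x y]] by (cases "F (cmb t x y)") auto
      have "F y \<le> ereal ((c - t * a) / (1 - t))"
      proof (rule F_le)
        fix h' assume h': "h' \<in> H" "h' \<sqsubseteq> y"
        have "F x \<le> ereal ((c - (1 - t) * q1 (h' 0)) / t)"
        proof (rule F_le)
          fix h assume "h \<in> H" "h \<sqsubseteq> x"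
          from pair[OF this h'] show "ereal (q1 (h 0)) \<le> ereal ((c - (1 - t) * q1 (h' 0)) / t)"
            using 3 by (simp add: c pos_le_divide_eq mult.commute)
        qed
        then show "ereal (q1 (h' 0)) \<le> ereal ((c - t * a) / (1 - t))"
          using 3 by (simp add: ab pos_le_divide_eq mult.commute)
      qed
      then show ?thesis using 3 by (simp add: ab c pos_le_divide_eq mult.commute)
    qed
  qed (simp_all add: cmb_eq flip: zero_ereal_def one_ereal_def)
qed

lemma F_ge:
  assumes x: "x \<in> Y" and c: "\<And>n. c < S n x"
  shows "ereal c \<le> F x"
proof -
  have "\<exists>h\<in>H. le n (h n) (x n) \<and> c \<le> q1 (h 0)" for n
  proof (rule ccontr)
    assume "\<not> ?thesis"
    then have "S n x \<le> c" by (intro S_least[OF x]) (meson linear)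
    then show False using c[of n] by simp
  qed
  then obtain h where "\<And>n. h n \<in> H" "\<And>n. le n (h n n) (x n)" "\<And>n. c \<le> q1 (h n 0)" by metis
  then obtain l where "l \<in> H" "l \<sqsubseteq> x" "c \<le> q1 (l 0)"
    using diagonal_lower_bound_in_H[OF _ Y_X[OF x]] by blast
  then show ?thesis using F_upper[of l x] by (meson ereal_less_eq(3) order_trans)
qed

lemma F_eq_Inf:
  assumes x: "x \<in> Y"
    and dom: "\<And>a h. P a \<Longrightarrow> h \<in> H \<Longrightarrow> h \<sqsubseteq> x \<Longrightarrow> q1 (h 0) \<le> a x"
    and ex: "\<And>n. \<exists>a. P a \<and> a x = S n x"
  shows "F x = Inf {ereal (a x) | a. P a}"
proof (rule antisym)
  show "F x \<le> Inf {ereal (a x) | a. P a}"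
    using dom by (auto intro!: Inf_greatest F_le)
  show "Inf {ereal (a x) | a. P a} \<le> F x"
  proof (rule dense_le)
    fix w :: ereal assume w: "w < Inf {ereal (a x) | a. P a}"
    have "w < ereal (S n x)" for n
    proof (rule less_le_trans[OF w Inf_lower])
      show "ereal (S n x) \<in> {ereal (a x) | a. P a}" using ex[of n] by (metis (mono_tags, lifting) mem_Collect_eq)
    qed
    then show "w \<le> F x"
      using F_ge[OF x] by (cases w) (auto intro: less_imp_le)
  qed
qed

lemma supporting_functional:
  assumes "x \<in> Y"
  shows "\<exists>l. linear l \<and> (\<forall>y\<in>Y. S n y \<le> S n x + l (y - x))"
  by (rule concave_supergradient[OF concave_S subspace_Y assms])

lemma F_eq_Inf_affine:
  assumes x: "x \<in> Y"
  shows "F x = Inf {ereal (a x) | a.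
      (\<forall>x1\<in>Y. \<forall>x2\<in>Y. \<forall>t::real. a (cmb t x1 x2) = t * a x1 + (1 - t) * a x2) \<and>
      (\<forall>h\<in>H. \<forall>x'\<in>Y. h \<sqsubseteq> x' \<longrightarrow> q1 (h 0) \<le> a x')}"
proof (rule F_eq_Inf[OF x])
  fix n
  obtain l where l: "linear l" "\<And>y. y \<in> Y \<Longrightarrow> S n y \<le> S n x + l (y - x)"
    using supporting_functional[OF x] by blast
  let ?a = "\<lambda>y. S n x + l (y - x)"
  have "?a (cmb t x1 x2) = t * ?a x1 + (1 - t) * ?a x2" for t x1 x2
    by (simp add: cmb_eq linear_add[OF l(1)] linear_diff[OF l(1)] linear_scale[OF l(1)] algebra_simps)
  moreover have "q1 (h 0) \<le> ?a x'" if "h \<in> H" "x' \<in> Y" "h \<sqsubseteq> x'" for h x'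
    using S_upper[OF that(1) Y_X[OF that(2)], of n] l(2)[OF that(2)] that(3) by (simp add: plim_le_def)
  moreover have "?a x = S n x" using linear_0[OF l(1)] by simp
  ultimately show "\<exists>a. ((\<forall>x1\<in>Y. \<forall>x2\<in>Y. \<forall>t::real. a (cmb t x1 x2) = t * a x1 + (1 - t) * a x2) \<and>
      (\<forall>h\<in>H. \<forall>x'\<in>Y. h \<sqsubseteq> x' \<longrightarrow> q1 (h 0) \<le> a x')) \<and> a x = S n x"
    by (intro exI[of _ ?a] conjI ballI allI impI) simp_all
qed (use x in blast)

lemma F_eq_Inf_positive:
  assumes x: "x \<in> Y" and zero: "(\<lambda>n. 0) \<in> H" "0 \<le> q1 0"
  shows "F x = Inf {ereal (l x + c) | l c.
      (\<forall>x1\<in>Y. \<forall>x2\<in>Y. l (padd x1 x2) = l x1 + l x2) \<and>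
      (\<forall>x1\<in>Y. \<forall>r::real. l (psc r x1) = r * l x1) \<and>
      (\<forall>x1\<in>Y. (\<lambda>n. 0) \<sqsubseteq> x1 \<longrightarrow> 0 \<le> l x1) \<and>
      0 \<le> c \<and>
      (\<forall>h\<in>H. \<forall>x'\<in>Y. h \<sqsubseteq> x' \<longrightarrow> q1 (h 0) \<le> l x' + c)}" (is "_ = Inf {ereal (l x + c) | l c. ?Q l c}")
proof -
  have affine_form: "{ereal (a x) | a. \<exists>l c. Q l c \<and> a = (\<lambda>y. l y + c)} = {ereal (l x + c) | l c. Q l c}"
    for Q :: "((nat \<Rightarrow> 'v) \<Rightarrow> real) \<Rightarrow> real \<Rightarrow> bool"
    by (rule Collect_cong) metis
  have "F x = Inf {ereal (a x) | a. \<exists>l c. ?Q l c \<and> a = (\<lambda>y. l y + c)}"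
  proof (rule F_eq_Inf[OF x])
    fix n
    obtain l where l: "linear l" "\<And>y. y \<in> Y \<Longrightarrow> S n y \<le> S n x + l (y - x)"
      using supporting_functional[OF x] by blast
    define c where "c = S n x - l x"
    have S_le: "S n y \<le> l y + c" if "y \<in> Y" for y
      using l(2)[OF that] by (simp add: c_def linear_diff[OF l(1)])
    have nonneg: "0 \<le> l y + c" if y: "y \<in> Y" "(\<lambda>n. 0) \<sqsubseteq> y" for y
    proof -
      have "q1 0 \<le> S n y"
        using S_upper[OF zero(1) Y_X[OF y(1)], of n] y(2) by (simp add: plim_le_def)
      then show ?thesis using S_le[OF y(1)] zero(2) by simp
    qed
    have "0 \<le> l y" if y: "y \<in> Y" "(\<lambda>n. 0) \<sqsubseteq> y" for y
    proof (rule ccontr)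
      assume neg: "\<not> 0 \<le> l y"
      have scaled: "0 \<le> r * l y + c" if "0 \<le> r" for r
      proof -
        have "le n 0 ((r *\<^sub>R y) n)" for n
          using le_scale[OF subspace_0[OF subspace_V] X_V[OF Y_X[OF y(1)]] that, of n] y(2)
          by (simp add: plim_le_def scaleR_fun_def)
        then show ?thesis
          using nonneg[of "r *\<^sub>R y"] subspace_scale[OF subspace_Y y(1)]
          by (simp add: plim_le_def linear_scale[OF l(1)])
      qed
      have "0 \<le> c" using scaled[of 0] by simp
      then show False using scaled[of "(c + 1) / - l y"] neg by (simp add: divide_simps)
    qed
    moreover have "0 \<le> c"
      using nonneg[of 0] subspace_0[OF subspace_Y] le_refl[OF subspace_0[OF subspace_V]] linear_0[OF l(1)]
      by (simp add: plim_le_def)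
    moreover have "q1 (h 0) \<le> l x' + c" if "h \<in> H" "x' \<in> Y" "h \<sqsubseteq> x'" for h x'
      using S_upper[OF that(1) Y_X[OF that(2)], of n] S_le[OF that(2)] that(3) by (simp add: plim_le_def)
    moreover have "padd x1 x2 = x1 + x2" "psc r x1 = r *\<^sub>R x1" for x1 x2 :: "nat \<Rightarrow> 'v" and r
      by (simp_all add: padd_def psc_def scaleR_fun_def plus_fun_def)
    ultimately have "?Q l c" by (simp add: linear_add[OF l(1)] linear_scale[OF l(1)])
    then show "\<exists>a. (\<exists>l c. ?Q l c \<and> a = (\<lambda>y. l y + c)) \<and> a x = S n x"
      by (intro exI[of _ "\<lambda>y. l y + c"] conjI exI[of _ l] exI[of _ c]) (auto simp: c_def)
  next
    fix a h assume "\<exists>l c. ?Q l c \<and> a = (\<lambda>y. l y + c)" "h \<in> H" "h \<sqsubseteq> x"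
    then show "q1 (h 0) \<le> a x" using x by blast
  qed
  also have "{ereal (a x) | a. \<exists>l c. ?Q l c \<and> a = (\<lambda>y. l y + c)} = {ereal (l x + c) | l c. ?Q l c}"
    by (rule affine_form)
  finally show ?thesis .
qed

end

theorem mainTheorem10:
  fixes V :: "nat \<Rightarrow> 'v::real_vector set"
    and le :: "nat \<Rightarrow> 'v \<Rightarrow> 'v \<Rightarrow> bool"
    and p :: "nat \<Rightarrow> 'v \<Rightarrow> 'v"
    and Y :: "(nat \<Rightarrow> 'v) set"
    and q1 :: "'v \<Rightarrow> real"
    and H :: "(nat \<Rightarrow> 'v) set"
  assumes reg: "regular_proj_system V le p"
    and red: "reduced V p"
    and Y_sub: "Y \<subseteq> plim V p" "(\<lambda>n. 0) \<in> Y"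
      "\<forall>x\<in>Y. \<forall>y\<in>Y. padd x y \<in> Y" "\<forall>x\<in>Y. \<forall>c. psc c x \<in> Y"
    and q1_incr: "\<forall>x\<in>V 0. \<forall>y\<in>V 0. le 0 x y \<longrightarrow> q1 x \<le> q1 y"
    and q1_concave: "\<forall>x\<in>V 0. \<forall>y\<in>V 0. \<forall>t\<in>{0..1::real}.
           t * q1 x + (1 - t) * q1 y \<le> q1 (t *\<^sub>R x + (1 - t) *\<^sub>R y)"
    and H_sub: "H \<subseteq> plim V p"
    and H_convex: "\<forall>x\<in>H. \<forall>y\<in>H. \<forall>t\<in>{0..1::real}. cmb t x y \<in> H"
    and ii: "\<forall>n. \<forall>y\<in>Y. \<exists>h\<in>H. le n (h n) (y n)"
    and v: "\<And>hs. (\<forall>k. hs k \<in> H) \<Longrightarrow> (\<forall>k. plim_le le (hs (Suc k)) (hs k)) \<Longrightarrow>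
              bdd_below (range (\<lambda>k. q1 (hs k 0))) \<Longrightarrow>
              (\<exists>b\<in>plim V p. \<forall>k. plim_le le b (hs k)) \<and>
              (\<forall>m. is_inf_in (plim V p) (plim_le le) (range hs) m \<longrightarrow>
                     (INF k. q1 (hs k 0)) \<le> q1 (m 0))"
    and iii_iv: "\<And>hs :: nat \<Rightarrow> nat \<Rightarrow> 'v. (\<forall>k. hs k \<in> H) \<Longrightarrow>
              (\<exists>a\<in>plim V p. \<exists>b\<in>plim V p. \<forall>k. plim_le le a (hs k) \<and> plim_le le (hs k) b) \<Longrightarrow>
              (\<exists>s. (\<forall>n. is_sup_in (plim V p) (plim_le le) (hs ` {n..}) (s n)) \<and>
                   (\<exists>l. is_inf_in (plim V p) (plim_le le) (range s) l \<and> l \<in> H))"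
  shows
    "(\<forall>x\<in>plim V p. spf H (plim_le le) (\<lambda>h. q1 (h 0)) x \<noteq> \<infinity>) \<and>
     (\<forall>x\<in>plim V p. \<forall>y\<in>plim V p. \<forall>t\<in>{0..1::real}.
        ereal t * spf H (plim_le le) (\<lambda>h. q1 (h 0)) x
          + ereal (1 - t) * spf H (plim_le le) (\<lambda>h. q1 (h 0)) y
        \<le> spf H (plim_le le) (\<lambda>h. q1 (h 0)) (cmb t x y)) \<and>
     (\<forall>x\<in>Y. spf H (plim_le le) (\<lambda>h. q1 (h 0)) x =
        Inf {ereal (a x) | a.
               (\<forall>x1\<in>Y. \<forall>x2\<in>Y. \<forall>t::real. a (cmb t x1 x2) = t * a x1 + (1 - t) * a x2) \<and>
               (\<forall>h\<in>H. \<forall>x'\<in>Y. plim_le le h x' \<longrightarrow> q1 (h 0) \<le> a x')}) \<and>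
     (((\<lambda>n. 0) \<in> H \<and> 0 \<le> q1 0) \<longrightarrow>
        (\<forall>x\<in>plim V p. plim_le le (\<lambda>n. 0) x \<longrightarrow> 0 \<le> spf H (plim_le le) (\<lambda>h. q1 (h 0)) x) \<and>
        (\<forall>x\<in>Y. spf H (plim_le le) (\<lambda>h. q1 (h 0)) x =
           Inf {ereal (l x + c) | l c.
                  (\<forall>x1\<in>Y. \<forall>x2\<in>Y. l (padd x1 x2) = l x1 + l x2) \<and>
                  (\<forall>x1\<in>Y. \<forall>r::real. l (psc r x1) = r * l x1) \<and>
                  (\<forall>x1\<in>Y. plim_le le (\<lambda>n. 0) x1 \<longrightarrow> 0 \<le> l x1) \<and>
                  0 \<le> c \<and>
                  (\<forall>h\<in>H. \<forall>x'\<in>Y. plim_le le h x' \<longrightarrow> q1 (h 0) \<le> l x' + c)}))"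
proof -
  interpret minorized_limit V le p q1 H Y
  proof unfold_locales
    have "padd x y = x + y" "psc r x = r *\<^sub>R x" for x y :: "nat \<Rightarrow> 'v" and r
      by (simp_all add: padd_def psc_def scaleR_fun_def plus_fun_def)
    then show "subspace Y" using Y_sub(2-4) by (simp add: subspace_def zero_fun_def)
    show "q1 a \<le> q1 b" if "a \<in> V 0" "b \<in> V 0" "le 0 a b" for a b
      using q1_incr that by blast
    show "t * q1 a + (1 - t) * q1 b \<le> q1 (t *\<^sub>R a + (1 - t) *\<^sub>R b)"
      if "a \<in> V 0" "b \<in> V 0" "t \<in> {0..1}" for a b and t :: real
      using q1_concave that by blast
    show "cmb t h h' \<in> H" if "h \<in> H" "h' \<in> H" "t \<in> {0..1}" for h h' and t :: real
      using H_convex that by blast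
    show "\<exists>h\<in>H. le n (h n) (y n)" if "y \<in> Y" for n y
      using ii that by blast
  qed (fact reg H_sub Y_sub(1) | erule (2) v | erule (1) iii_iv)+
  have "0 \<le> F x" if "(\<lambda>n. 0) \<in> H" "0 \<le> q1 0" "(\<lambda>n. 0) \<sqsubseteq> x" for x
    using F_upper[OF that(1,3)] that(2) by (simp add: order_trans[rotated])
  then show ?thesis
    using F_not_PInf F_cmb F_eq_Inf_affine F_eq_Inf_positive by simp
qed

end
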